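(* Let $N$ be the planning horizon, $n_w$ the dimension of the uncertainty and $m$ the number of inequalities of the polyhedral support estimate $\mathbf{W}[K_w]$. Let $\epsilon,\beta\in(0,1)$ be the desired violation and confidence parameter, respectively. For $K_w$ such that $$K_w\ge\frac{e}{e-1}\frac{1}{\epsilon}\Big(\ln\Big(\frac{1}{\beta}\Big)+m(N+1)n_w+m-1\Big),$$ the solution $\overline{\mathbf{H}}^\star[K_w]$ of $\overline{\mathbf{RP}}[K_w]$ satisfies $$\mathbb{P}^{K_w}\big[V_\varphi(\overline{\mathbf{H}}^\star[K_w])>\epsilon\big]\le\beta\quad\text{and}\quad\mathbb{P}^{K_w}\big[V_s(\overline{\mathbf{H}}^\star[K_w])>\epsilon\big]\le\beta .$$
   Context: **Setting (linear dependence on the uncertainty).** Fix a horizon $N$, an initial state $x_0\in\mathbb{R}^{n_x}$ and a system $x_{k+1}=Ax_k+Bu_k+c(w_k)$ with $x_k\in\mathbb{R}^{n_x}$, $u_k\in\mathbb{R}^{n_u}$, $w_k\in\mathbb{R}^{n_w}$, constant matrices $A,B$, and $c$ affine in $w$. The disturbance sequence $\mathbf{w}=(w_0,\dots,w_N)\in\mathbb{R}^{(N+1)n_w}$ is a random variable with (unknown, arbitrary) distribution $\mathbb{P}$ and support set $\mathbf{W}$. The trajectory is $\mathbf{x}=(x_0,\dots,x_N)=\mathbf{A}x_0+\mathbf{B}\mathbf{u}(\mathbf{w})+\mathbf{c}(\mathbf{w})$, with $\mathbf{A},\mathbf{B},\mathbf{c}$ obtained by iterating the dynamics ($\mathbf{A},\mathbf{B}$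 constant, $\mathbf{c}$ affine in $\mathbf{w}$). A bounded linear temporal logic specification $\varphi$, whose atomic propositions are of the form $P_ix\le\rho_i(w)$ with $P_i$ constant and $\rho_i$ affine, is encoded by $\exists\delta\in\Delta:=\mathbb{R}^{n_c}\times\{0,1\}^{n_b}$ with $F^x\mathbf{x}+F^\delta\delta+f(\mathbf{w})\le0$, where $F^x,F^\delta$ are given constant matrices and $f$ is affine; polyhedral state-input constraints are written $S^x\big(\mathbf{A}x_0+\mathbf{B}\mathbf{u}(\mathbf{w})\big)+S^u\mathbf{u}(\mathbf{w})+s(\mathbf{w})\le0$ with $S^x,S^u$ constant and $s$ affine. **Support estimate.** Given $K_w$ i.i.d. samples $\mathbf{w}^{(1)},\dots,\mathbf{w}^{(K_w)}$ of $\mathbf{w}$ (jointly distributed as $\mathbb{P}^{K_w}$), the estimate of $\mathbf{W}$ is the polyhedron $\mathbf{W}[K_w]:=\{\mathbf{w}\in\mathbb{R}^{(N+1)n_w}:\ W\mathbf{w}\le v\}$ with $W\in\mathbb{R}^{m\times(N+1)n_w}$, $v\in\mathbb{R}^m$. It is computed by the scenario approach: the parameters $(W,v)$ are the unique optimizer, assumed to exist, of a convex optimization problem minimizing a (convex) measure of the size of the polyhedron, possibly with additional convex constraints on $(W,v)$ not depending on the samples (e.g. $W$ fixed), subject to $W\mathbf{w}^{(k)}\le v$ for all $k=1,\dots,K_w$. **Policy and robust program.** Let $\{\mathbf{K}_i\}_{i=1}^P$ be a polyhedral partition of $\mathbf{W}[K_w]$. The policy is causal (i.e. $u_k$ depends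 only on $w_0,\dots,w_k$) and piecewise affine: $\mathbf{u}(\mathbf{w})=\mathbf{H}_i\begin{bmatrix}1\\ \mathbf{w}\end{bmatrix}$ if $\mathbf{w}\in\mathbf{K}_i$ and $\mathbf{u}(\mathbf{w})=0$ if $\mathbf{w}$ is in none of the $\mathbf{K}_i$, with $\mathbf{H}=[\mathbf{H}_1\ \cdots\ \mathbf{H}_P]\in\mathcal{H}$, $\mathcal{H}$ a polyhedral set enforcing causality. The recourse $\delta$ is piecewise constant on the same partition: $\boldsymbol{\delta}=(\delta_1,\dots,\delta_P)\in\boldsymbol{\Delta}:=\Delta^P$. Set $$\gamma_{\varphi,i}(\mathbf{H}_i,\delta_i,\mathbf{w}):=F^x\Big(\mathbf{A}x_0+\mathbf{B}\mathbf{H}_i\begin{bmatrix}1\\ \mathbf{w}\end{bmatrix}\Big)+F^\delta\delta_i+F^x\mathbf{c}(\mathbf{w})+f(\mathbf{w}),$$ $$\gamma_{s,i}(\mathbf{H}_i,\mathbf{w}):=S^x\Big(\mathbf{A}x_0+\mathbf{B}\mathbf{H}_i\begin{bmatrix}1\\ \mathbf{w}\end{bmatrix}\Big)+S^u\mathbf{H}_i\begin{bmatrix}1\\ \mathbf{w}\end{bmatrix}+s(\mathbf{w}).$$ With $J$ linear or convex quadratic, $\overline{\mathbf{RP}}[K_w]$ is: minimize $J(\mathbf{H})$ over $\mathbf{H}\in\mathcal{H}$, $\boldsymbol{\delta}\in\boldsymbol{\Delta}$ subject to $$\max_{i=1,\dots,P}\ \max_{\mathbf{w}\in\mathbf{K}_i}\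 \max_j\begin{bmatrix}\gamma_{\varphi,i}(\mathbf{H}_i,\delta_i,\mathbf{w})\\ \gamma_{s,i}(\mathbf{H}_i,\mathbf{w})\end{bmatrix}_j\le0 .$$ Its optimizer $(\overline{\mathbf{H}}^\star[K_w],\overline{\boldsymbol{\delta}}^\star[K_w])$ is a random variable depending on the samples through $\mathbf{W}[K_w]$. **Violation probabilities.** With $\mathbf{u}(\cdot)$ the policy given by $\mathbf{H}$, $V_\varphi(\mathbf{H}):=\mathbb{P}\{\mathbf{w}\in\mathbf{W}:\ \min_{\delta\in\Delta}\max_j[F^x(\mathbf{A}x_0+\mathbf{B}\mathbf{u}(\mathbf{w})+\mathbf{c}(\mathbf{w}))+F^\delta\delta+f(\mathbf{w})]_j>0\}$ and $V_s(\mathbf{H}):=\mathbb{P}\{\mathbf{w}\in\mathbf{W}:\ \exists j,\ [S^x(\mathbf{A}x_0+\mathbf{B}\mathbf{u}(\mathbf{w}))+S^u\mathbf{u}(\mathbf{w})+s(\mathbf{w})]_j>0\}$. Here $e$ is Euler's number and $\ln$ the natural logarithm. *)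

theory Defs
  imports "HOL-Probability.Probability"
begin

section \<open>Stacked sequences\<close>

text \<open>
  A sequence indexed by the time steps \<open>0, \<dots>, N\<close> with values in \<open>\<real>\<^sup>n\<close> is a vector
  in \<open>\<real>^('t \<times> 'n)\<close>, where \<open>'t\<close> is a finite type whose elements are numbered by a
  bijection \<open>step :: 't \<Rightarrow> nat\<close> onto \<open>{0..N}\<close>.
\<close>

definition block :: "real^('t::finite \<times> 'n::finite) \<Rightarrow> 't \<Rightarrow> real^'n"
  where "block z t = (\<chi> i. z $ (t, i))"

text \<open>The column vector with entries \<open>1\<close> (index \<open>None\<close>) and \<open>w\<close>.\<close>

definition aug :: "real^'k::finite \<Rightarrow> real^('k option)"
  where "aug w = (\<chi> i. case i of None \<Rightarrow> 1 | Some j \<Rightarrow> w $ j)"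

definition affine_map :: "(real^'n::finite \<Rightarrow> real^'m::finite) \<Rightarrow> bool"
  where "affine_map g \<longleftrightarrow> (\<exists>M b. \<forall>w. g w = M *v w + b)"

section \<open>Trajectories\<close>

text \<open>The power of a square matrix; \<open>^\<close> would be taken entrywise.\<close>

definition mpow :: "real^'n^'n \<Rightarrow> nat \<Rightarrow> real^'n^'n::finite"
  where "mpow A k = (((**) A) ^^ k) (mat 1)"

definition bigA :: "('t::finite \<Rightarrow> nat) \<Rightarrow> real^'nx^'nx \<Rightarrow> real^'nx^('t \<times> 'nx::finite)"
  where "bigA step A = (\<chi> p. row (snd p) (mpow A (step (fst p))))"

definition bigB ::
  "('t::finite \<Rightarrow> nat) \<Rightarrow> real^'nx^'nx \<Rightarrow> real^'nu^'nx
    \<Rightarrow> real^('t \<times> 'nu::finite)^('t \<times> 'nx::finite)"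
  where "bigB step A B =
    (\<chi> p q. if step (fst q) < step (fst p)
             then (mpow A (step (fst p) - 1 - step (fst q)) ** B) $ snd p $ snd q else 0)"

definition bigc ::
  "('t::finite \<Rightarrow> nat) \<Rightarrow> real^'nx^'nx \<Rightarrow> (real^'nw \<Rightarrow> real^'nx)
    \<Rightarrow> real^('t \<times> 'nw::finite) \<Rightarrow> real^('t \<times> 'nx::finite)"
  where "bigc step A c w =
    (\<chi> p. (\<Sum>s | step s < step (fst p).
            mpow A (step (fst p) - 1 - step s) *v c (block w s)) $ snd p)"

text \<open>These are the matrices and the map obtained by iterating the dynamics:\<close>

lemma mpow_Suc: "mpow A (Suc k) = A ** mpow A k"
  by (simp add: mpow_def)

lemma block_bigA: "block (bigA step A *v x0) t = mpow A (step t) *v x0"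
  by (simp add: block_def bigA_def vec_eq_iff matrix_vector_mult_def row_def)

lemma block_bigc: "block (bigc step A c w) t =
  (\<Sum>s | step s < step t. mpow A (step t - 1 - step s) *v c (block w s))"
  by (simp add: block_def bigc_def vec_eq_iff)

lemma block_bigB: "block (bigB step A B *v u) t =
  (\<Sum>s | step s < step t. mpow A (step t - 1 - step s) *v (B *v block u s))"
proof -
  have "block (bigB step A B *v u) t $ i =
     (\<Sum>s | step s < step t. mpow A (step t - 1 - step s) *v (B *v block u s)) $ i" for i
  proof -
    have "block (bigB step A B *v u) t $ i = (\<Sum>q\<in>UNIV \<times> UNIV. bigB step A B $ (t, i) $ q * u $ q)"
      by (simp add: block_def matrix_vector_mult_def)
    also have "\<dots> = (\<Sum>s\<in>UNIV. \<Sum>j\<in>UNIV. bigB step A B $ (t, i) $ (s, j) * u $ (s, j))"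
      by (simp add: sum.cartesian_product)
    also have "\<dots> = (\<Sum>s\<in>UNIV. if step s < step t
        then (mpow A (step t - 1 - step s) *v (B *v block u s)) $ i else 0)"
      by (intro sum.cong refl)
        (simp only: matrix_vector_mul_assoc, simp add: bigB_def matrix_vector_mult_def block_def)
    also have "\<dots> = (\<Sum>s | step s < step t. (mpow A (step t - 1 - step s) *v (B *v block u s)) $ i)"
      by (simp add: sum.If_cases)
    finally show ?thesis by simp
  qed
  then show ?thesis by (simp add: vec_eq_iff)
qed

lemma trajectory_iterates_dynamics:
  fixes N :: nat and step :: "'t::finite \<Rightarrow> nat"
    and A :: "real^'nx^'nx::finite" and B :: "real^'nu^'nx" and c :: "real^'nw \<Rightarrow> real^'nx"
    and x0 :: "real^'nx" and u :: "real^('t \<times> 'nu::finite)" and w :: "real^('t \<times> 'nw::finite)"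
  defines "x \<equiv> bigA step A *v x0 + bigB step A B *v u + bigc step A c w"
  assumes "bij_betw step UNIV {0..N}"
  shows "step t = 0 \<Longrightarrow> block x t = x0"
    and "step t' = Suc (step t) \<Longrightarrow>
      block x t' = A *v block x t + B *v block u t + c (block w t)"
proof -
  have inj: "inj step" using assms(2) by (simp add: bij_betw_def)
  have blk: "block x r = mpow A (step r) *v x0
      + (\<Sum>s | step s < step r. mpow A (step r - 1 - step s) *v (B *v block u s + c (block w s)))" for r
  proof -
    have "block x r = block (bigA step A *v x0) r + block (bigB step A B *v u) r
        + block (bigc step A c w) r"
      by (simp add: x_def block_def vec_eq_iff)
    then show ?thesis
      by (simp add: block_bigA block_bigB block_bigc matrix_vector_right_distrib sum.distrib)
  qed
  show "block x t = x0" if "step t = 0"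
    using that by (simp add: blk mpow_def)
  assume st: "step t' = Suc (step t)"
  have set: "{s. step s < step t'} = insert t {s. step s < step t}"
    using st inj by (auto simp: less_Suc_eq inj_def)
  let ?d = "\<lambda>s. B *v block u s + c (block w s)"
  have "(\<Sum>s | step s < step t. mpow A (step t - step s) *v ?d s)
      = (\<Sum>s | step s < step t. A *v (mpow A (step t - 1 - step s) *v ?d s))"
  proof (intro sum.cong refl)
    fix s assume "s \<in> {s. step s < step t}"
    then have "step t - step s = Suc (step t - 1 - step s)" by simp
    then show "mpow A (step t - step s) *v ?d s = A *v (mpow A (step t - 1 - step s) *v ?d s)"
      by (simp only: mpow_Suc matrix_vector_mul_assoc)
  qed
  also have "\<dots> = A *v (\<Sum>s | step s < step t. mpow A (step t - 1 - step s) *v ?d s)"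
    by (simp add: linear_sum matrix_vector_mul_linear)
  finally have sums: "(\<Sum>s | step s < step t. mpow A (step t - step s) *v ?d s) = \<dots>" .
  have "block x t' = mpow A (Suc (step t)) *v x0
      + (mpow A 0 *v ?d t + (\<Sum>s | step s < step t. mpow A (step t - step s) *v ?d s))"
    unfolding blk set using st by simp
  also have "\<dots> = A *v block x t + ?d t"
    unfolding blk sums
    by (simp add: mpow_Suc matrix_vector_right_distrib flip: matrix_vector_mul_assoc)
       (simp add: mpow_def)
  finally show "block x t' = A *v block x t + B *v block u t + c (block w t)"
    by (simp add: add.assoc)
qed

section \<open>Distribution and support estimate\<close>

definition measure_support :: "'a::topological_space measure \<Rightarrow> 'a set"
  where "measure_support M = {x. \<forall>U. open U \<longrightarrow> x \<in> U \<longrightarrow> emeasure M U > 0}"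

text \<open>The parameters \<open>(W, v)\<close> of a polyhedron with \<open>m\<close> inequalities.\<close>

type_synonym ('k, 'm) param = "(real^'k^'m) \<times> (real^'m)"

definition estimate :: "('k::finite, 'm::finite) param \<Rightarrow> (real^'k) set"
  where "estimate \<theta> = {w. \<forall>i. (fst \<theta> *v w) $ i \<le> snd \<theta> $ i}"

text \<open>
  The scenario program for the samples \<open>\<omega> 1, \<dots>, \<omega> K\<close>: the convex set \<open>D\<close> collects the
  constraints on the parameters that do not depend on the samples.
\<close>

definition scenario_feasible ::
  "(('k::finite, 'm::finite) param) set \<Rightarrow> nat \<Rightarrow> (nat \<Rightarrow> real^'k) \<Rightarrow> ('k, 'm) param \<Rightarrow> bool"
  where "scenario_feasible D K \<omega> \<theta> \<longleftrightarrow> \<theta> \<in> D \<and> (\<forall>k\<in>{1..K}. \<omega> k \<in> estimate \<theta>)"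

definition unique_scenario_optimizer ::
  "(('k::finite, 'm::finite) param \<Rightarrow> real) \<Rightarrow> (('k, 'm) param) set \<Rightarrow> nat
    \<Rightarrow> (nat \<Rightarrow> real^'k) \<Rightarrow> ('k, 'm) param \<Rightarrow> bool"
  where "unique_scenario_optimizer \<mu> D K \<omega> \<theta> \<longleftrightarrow>
    (\<forall>\<theta>'. is_arg_min \<mu> (scenario_feasible D K \<omega>) \<theta>' \<longleftrightarrow> \<theta>' = \<theta>)"

section \<open>Policies\<close>

text \<open>
  Cells may contain only part of their boundary, so that both partitions into disjoint cells
  and partitions into closed polyhedra with disjoint interiors are covered.
\<close>

definition polyhedral_cell :: "'a::euclidean_space set \<Rightarrow> bool"
  where "polyhedral_cell S \<longleftrightarrow> (\<exists>F G. finite F \<and> finite G \<and>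
    S = {x. (\<forall>(a, b)\<in>F. a \<bullet> x \<le> b) \<and> (\<forall>(a, b)\<in>G. a \<bullet> x < b)})"

definition polyhedral_partition :: "'a::euclidean_space set \<Rightarrow> ('p::finite \<Rightarrow> 'a set) \<Rightarrow> bool"
  where "polyhedral_partition S C \<longleftrightarrow>
    (\<forall>i. polyhedral_cell (C i)) \<and> (\<Union>i. C i) = S \<and>
    (\<forall>i j. i \<noteq> j \<longrightarrow> interior (C i) \<inter> interior (C j) = {})"

type_synonym ('t, 'nu, 'nw) gain = "real^(('t \<times> 'nw) option)^('t \<times> 'nu)"

text \<open>On a common boundary of several cells, an arbitrary one of them is used.\<close>

definition policy ::
  "('p \<Rightarrow> (real^('t \<times> 'nw)) set) \<Rightarrow> (('t::finite, 'nu::finite, 'nw::finite) gain)^'p::finite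
    \<Rightarrow> real^('t \<times> 'nw) \<Rightarrow> real^('t \<times> 'nu)"
  where "policy C H w =
    (if \<exists>i. w \<in> C i then (H $ (SOME i. w \<in> C i)) *v aug w else 0)"

definition causal_on ::
  "('t \<Rightarrow> nat) \<Rightarrow> (real^('t \<times> 'nw)) set
    \<Rightarrow> (real^('t::finite \<times> 'nw::finite) \<Rightarrow> real^('t \<times> 'nu::finite)) \<Rightarrow> bool"
  where "causal_on step S u \<longleftrightarrow> (\<forall>w\<in>S. \<forall>w'\<in>S. \<forall>t.
    (\<forall>s. step s \<le> step t \<longrightarrow> block w s = block w' s) \<longrightarrow> block (u w) t = block (u w') t)"

section \<open>Robust program and violation probabilities\<close>

text \<open>
  Below, \<open>a\<close>, \<open>BB\<close> and \<open>cc\<close> stand for \<open>bigA step A *v x0\<close>, \<open>bigB step A B\<close> and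
  \<open>bigc step A c\<close>. The components of \<open>\<delta>\<close> with index in \<open>Bin\<close> are binary.
\<close>

definition recourse :: "'d set \<Rightarrow> (real^'d::finite) set"
  where "recourse Bin = {\<delta>. \<forall>i\<in>Bin. \<delta> $ i \<in> {0, 1}}"

definition gamma_phi ::
  "real^('t \<times> 'nx::finite)^'q \<Rightarrow> real^'d^'q \<Rightarrow> (real^('t \<times> 'nw) \<Rightarrow> real^'q)
    \<Rightarrow> real^('t \<times> 'nx) \<Rightarrow> real^('t \<times> 'nu)^('t \<times> 'nx) \<Rightarrow> (real^('t \<times> 'nw) \<Rightarrow> real^('t \<times> 'nx))
    \<Rightarrow> ('t::finite, 'nu::finite, 'nw::finite) gain \<Rightarrow> real^'d::finite \<Rightarrow> real^('t \<times> 'nw)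
    \<Rightarrow> real^'q::finite"
  where "gamma_phi Fx Fd f a BB cc Hi di w =
    Fx *v (a + BB *v (Hi *v aug w)) + Fd *v di + Fx *v cc w + f w"

definition gamma_s ::
  "real^('t \<times> 'nx::finite)^'r \<Rightarrow> real^('t \<times> 'nu)^'r \<Rightarrow> (real^('t \<times> 'nw) \<Rightarrow> real^'r)
    \<Rightarrow> real^('t \<times> 'nx) \<Rightarrow> real^('t \<times> 'nu)^('t \<times> 'nx)
    \<Rightarrow> ('t::finite, 'nu::finite, 'nw::finite) gain \<Rightarrow> real^('t \<times> 'nw) \<Rightarrow> real^'r::finite"
  where "gamma_s Sx Su s a BB Hi w =
    Sx *v (a + BB *v (Hi *v aug w)) + Su *v (Hi *v aug w) + s w"

definition linear_or_convex_quadratic :: "('a::euclidean_space \<Rightarrow> real) \<Rightarrow> bool"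
  where "linear_or_convex_quadratic J \<longleftrightarrow> linear J \<or>
    convex_on UNIV J \<and> (\<exists>Q q r. linear Q \<and> (\<forall>H. J H = H \<bullet> Q H + q \<bullet> H + r))"

text \<open>
  The nested maximum is a supremum in the extended reals, since cells may be empty or
  unbounded.
\<close>

definition rp_feasible ::
  "'d set \<Rightarrow> ('p \<Rightarrow> (real^('t \<times> 'nw)) set)
    \<Rightarrow> (('t::finite, 'nu::finite, 'nw::finite) gain \<Rightarrow> real^'d::finite \<Rightarrow> real^('t \<times> 'nw) \<Rightarrow> real^'q::finite)
    \<Rightarrow> (('t, 'nu, 'nw) gain \<Rightarrow> real^('t \<times> 'nw) \<Rightarrow> real^'r::finite)
    \<Rightarrow> ((('t, 'nu, 'nw) gain)^'p::finite) set
    \<Rightarrow> ((('t, 'nu, 'nw) gain)^'p) \<times> ((real^'d)^'p) \<Rightarrow> bool"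
  where "rp_feasible Bin C \<gamma>\<phi> \<gamma>s \<H> = (\<lambda>(H, \<delta>).
    H \<in> \<H> \<and> (\<forall>i. \<delta> $ i \<in> recourse Bin) \<and>
    (SUP i. SUP w\<in>C i. ereal (max (MAX j. \<gamma>\<phi> (H $ i) (\<delta> $ i) w $ j) (MAX j. \<gamma>s (H $ i) w $ j))) \<le> 0)"

text \<open>
  The minimum over the recourse is an infimum in the extended reals; it is either attained
  or equal to \<open>-\<infinity>\<close>.
\<close>

definition V_phi ::
  "(real^('t \<times> 'nw)) measure \<Rightarrow> 'd::finite set
    \<Rightarrow> real^('t \<times> 'nx::finite)^'q::finite \<Rightarrow> real^'d^'q \<Rightarrow> (real^('t \<times> 'nw) \<Rightarrow> real^'q)
    \<Rightarrow> real^('t \<times> 'nx) \<Rightarrow> real^('t \<times> 'nu)^('t \<times> 'nx) \<Rightarrow> (real^('t \<times> 'nw) \<Rightarrow> real^('t \<times> 'nx))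
    \<Rightarrow> (real^('t::finite \<times> 'nw::finite) \<Rightarrow> real^('t \<times> 'nu::finite)) \<Rightarrow> real"
  where "V_phi P Bin Fx Fd f a BB cc u =
    measure P {w \<in> measure_support P.
      (INF \<delta>\<in>recourse Bin.
        ereal (MAX j.
          (Fx *v (a + BB *v u w + cc w) + Fd *v \<delta> + f w) $ j)) > 0}"

definition V_s ::
  "(real^('t \<times> 'nw)) measure
    \<Rightarrow> real^('t \<times> 'nx::finite)^'r::finite \<Rightarrow> real^('t \<times> 'nu)^'r \<Rightarrow> (real^('t \<times> 'nw) \<Rightarrow> real^'r)
    \<Rightarrow> real^('t \<times> 'nx) \<Rightarrow> real^('t \<times> 'nu)^('t \<times> 'nx)
    \<Rightarrow> (real^('t::finite \<times> 'nw::finite) \<Rightarrow> real^('t \<times> 'nu::finite)) \<Rightarrow> real"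
  where "V_s P Sx Su s a BB u =
    measure P {w \<in> measure_support P.
      \<exists>j. (Sx *v (a + BB *v u w) + Su *v u w + s w) $ j > 0}"

end

theory Submission
  imports Defs
begin

text \<open>
  Each sample constrains the parameters of the polyhedron to a convex cone, so the ray through
  a nonzero optimizer is feasible along with it. A Radon argument that uses this additional point
  shows that at most \<open>d - 1\<close> samples determine a nonzero optimizer, where \<open>d\<close> is the number
  of parameters; for the optimizer \<open>0\<close> the estimate is the whole space and nothing is violated.

  Keep each sample independently with probability \<open>p\<close>. With probability at least
  \<open>p^(d - 1)\<close> the kept set contains the determining samples; then it yields the same
  optimizer, which the remaining samples satisfy. If the violation probability exceeds \<open>\<epsilon>\<close>,
  each of the remaining, independent samples is satisfied with probability at most \<open>1 - \<epsilon>\<close>. Hence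
  \<open>p^(d - 1) Prob(V > \<epsilon>) \<le> (p + (1 - p)(1 - \<epsilon>))^K\<close>, and \<open>p = 1/e\<close> gives the sample size.
\<close>

section \<open>A Helly-type theorem for convex cones\<close>

text \<open>In a subfamily \<open>B\<close> of least size, each \<open>i\<close> has a point
  \<open>y i\<close> of \<open>L\<close> that lies in all cones of \<open>B\<close> except
  \<open>X i\<close>. These points and \<open>p\<close> are linearly dependent if
  \<open>card B\<close> is at least the dimension. Since the \<open>X i\<close> are cones, a linear
  relation can replace the affine one of Radon's argument, and including \<open>p\<close> lowers the
  bound by one.\<close>

lemma cone_helly:
  fixes X :: "'i \<Rightarrow> 'a::euclidean_space set"
  assumes fin: "finite I" and cones: "\<And>i. i \<in> I \<Longrightarrow> convex_cone (X i)"
    and L: "convex L" "0 \<notin> L" "L \<inter> (\<Inter>i\<in>I. X i) = {}"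
    and p: "p \<noteq> 0" "p \<in> (\<Inter>i\<in>I. X i)" "\<And>r. r > 0 \<Longrightarrow> - r *\<^sub>R p \<notin> L"
  obtains B where "B \<subseteq> I" "card B < DIM('a)" "L \<inter> (\<Inter>i\<in>B. X i) = {}"
proof -
  let ?Q = "\<lambda>B. B \<subseteq> I \<and> L \<inter> (\<Inter>i\<in>B. X i) = {}"
  obtain B where B: "?Q B" and least: "\<And>B'. ?Q B' \<Longrightarrow> card B \<le> card B'"
    using arg_min_nat_lemma[of ?Q I card] L(3) by auto
  have finB: "finite B" using B fin finite_subset by blast
  have "card B < DIM('a)"
  proof (rule ccontr)
    assume ge: "\<not> card B < DIM('a)"
    have "\<exists>y. y \<in> L \<and> y \<in> (\<Inter>j\<in>B - {i}. X j)" if "i \<in> B" for i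
    proof -
      have "card (B - {i}) < card B" using that finB by (rule card_Diff1_less[rotated])
      then have "\<not> ?Q (B - {i})" using least[of "B - {i}"] by linarith
      then show ?thesis using B by blast
    qed
    then obtain y where y: "\<And>i. i \<in> B \<Longrightarrow> y i \<in> L" "\<And>i j. i \<in> B \<Longrightarrow> j \<in> B \<Longrightarrow> i \<noteq> j \<Longrightarrow> y i \<in> X j"
      by (metis DiffI INT_iff singletonD)
    have conesB: "convex_cone (X j)" if "j \<in> B" for j using that B cones by blast
    have empty: "z \<notin> L" if "\<And>j. j \<in> B \<Longrightarrow> z \<in> X j" for z using that B by blast
    have pX: "p \<in> X j" if "j \<in> B" for j using that B p(2) by blast
    \<comment> \<open>If \<open>y i = y j\<close> with distinct \<open>i\<close> and
      \<open>j\<close>, the common point would also lie in \<open>X i\<close>, hence in every cone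
      of \<open>B\<close> and in \<open>L\<close>.\<close>
    have inj: "inj_on y B"
      by (rule inj_onI) (metis empty y)
    have "p \<notin> y ` B" using empty pX y(1) by blast
    then have "card (insert p (y ` B)) > DIM('a)"
      using ge finB inj by (simp add: card_image)
    then have "dependent (insert p (y ` B))" using dependent_biggerset by blast
    then obtain u v where u: "v \<in> insert p (y ` B)" "u v \<noteq> (0::real)"
        "(\<Sum>v\<in>insert p (y ` B). u v *\<^sub>R v) = 0"
      using finB by (auto simp: dependent_finite)
    \<comment> \<open>The relation is normalized so that \<open>p\<close> has a nonnegative
      coefficient: \<open>p\<close> then stays on the side of the positive terms in
      \<open>split\<close>.\<close>
    define c where "c = (if u p \<ge> 0 then u else (\<lambda>v. - u v))"
    have "(\<Sum>v\<in>insert p (y ` B). c v *\<^sub>R v) = 0"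
      using u(3) by (simp add: c_def sum_negf)
    then have "c p *\<^sub>R p + (\<Sum>v\<in>y ` B. c v *\<^sub>R v) = 0"
      using \<open>p \<notin> y ` B\<close> finB by simp
    then have rel: "c p *\<^sub>R p + (\<Sum>i\<in>B. c (y i) *\<^sub>R y i) = 0"
      by (simp add: sum.reindex[OF inj])
    have cp: "c p \<ge> 0" by (simp add: c_def)
    have nz: "c p \<noteq> 0 \<or> (\<exists>i\<in>B. c (y i) \<noteq> 0)"
      using u(1,2) by (auto simp: c_def split: if_splits)
    define Neg where "Neg = {i\<in>B. c (y i) < 0}"
    define Pos where "Pos = {i\<in>B. c (y i) > 0}"
    have sub: "Neg \<subseteq> B" "Pos \<subseteq> B" "finite Neg" "finite Pos" using finB by (auto simp: Neg_def Pos_def)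
    have "(\<Sum>i\<in>B. c (y i) *\<^sub>R y i) = (\<Sum>i\<in>Neg \<union> Pos. c (y i) *\<^sub>R y i)"
      using finB by (intro sum.mono_neutral_right) (auto simp: Neg_def Pos_def)
    also have "\<dots> = (\<Sum>i\<in>Neg. c (y i) *\<^sub>R y i) + (\<Sum>i\<in>Pos. c (y i) *\<^sub>R y i)"
      using sub by (intro sum.union_disjoint) (auto simp: Neg_def Pos_def)
    finally have split: "(\<Sum>i\<in>Neg. (- c (y i)) *\<^sub>R y i) = c p *\<^sub>R p + (\<Sum>i\<in>Pos. c (y i) *\<^sub>R y i)"
      using rel by (simp add: sum_negf neg_eq_iff_add_eq_0 algebra_simps)
    have avg: "(1 / sum a S) *\<^sub>R (\<Sum>i\<in>S. a i *\<^sub>R y i) \<in> L"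
      if "S \<subseteq> B" "S \<noteq> {}" "\<And>i. i \<in> S \<Longrightarrow> a i > 0" for S and a :: "'i \<Rightarrow> real"
    proof -
      have "finite S" using that(1) finB finite_subset by blast
      then have "sum a S > 0" using that by (simp add: sum_pos)
      then have "(\<Sum>i\<in>S. (a i / sum a S) *\<^sub>R y i) \<in> L"
        using that \<open>finite S\<close> y(1)
        by (intro convex_sum[OF \<open>finite S\<close> L(1)])
          (auto simp: less_imp_le simp flip: sum_divide_distrib)
      then show ?thesis by (simp add: scaleR_sum_right)
    qed
    have comb: "(\<Sum>i\<in>S. a i *\<^sub>R y i) \<in> X j"
      if "j \<in> B" "S \<subseteq> B" "j \<notin> S" "\<And>i. i \<in> S \<Longrightarrow> a i \<ge> 0" for S j and a :: "'i \<Rightarrow> real"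
    proof -
      have "finite S" using that(2) finB finite_subset by blast
      then show ?thesis using that
        by (induction S rule: finite_induct)
          (auto intro!: convex_cone_add convex_cone_scaleR convex_cone_contains_0 conesB y(2))
    qed
    show False
    proof (cases "Neg = {}")
      case False
      \<comment> \<open>Both sides of \<open>split\<close> express \<open>q\<close>. The left one
        shows membership in \<open>X j\<close> for \<open>j\<close> outside \<open>Neg\<close>, the
        right one for \<open>j\<close> in \<open>Neg\<close>. Rescaled to a convex combination,
        \<open>q\<close> also lies in \<open>L\<close>.\<close>
      define q where "q = (\<Sum>i\<in>Neg. (- c (y i)) *\<^sub>R y i)"
      have "q \<in> X j" if "j \<in> B" for j
      proof (cases "j \<in> Neg")
        case True
        then have "j \<notin> Pos" by (auto simp: Neg_def Pos_def)
        then show ?thesis unfolding q_def split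
          using that sub cp
          by (intro convex_cone_add convex_cone_scaleR comb conesB pX) (auto simp: Pos_def)
      next
        case False
        then show ?thesis unfolding q_def
          using that sub by (intro comb) (auto simp: Neg_def)
      qed
      moreover have "sum (\<lambda>i. - c (y i)) Neg \<ge> 0" by (intro sum_nonneg) (auto simp: Neg_def)
      ultimately have "(1 / sum (\<lambda>i. - c (y i)) Neg) *\<^sub>R q \<notin> L"
        by (intro empty convex_cone_scaleR conesB) auto
      moreover have "(1 / sum (\<lambda>i. - c (y i)) Neg) *\<^sub>R q \<in> L"
        unfolding q_def using False sub(1) by (intro avg) (auto simp: Neg_def)
      ultimately show False by blast
    next
      case True
      \<comment> \<open>Without negative terms, a convex combination of points of \<open>L\<close>
        equals \<open>0\<close> or a negative multiple of \<open>p\<close>; \<open>L(2)\<close> and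
        \<open>p(3)\<close> exclude these two cases.\<close>
      then have eq: "(\<Sum>i\<in>Pos. c (y i) *\<^sub>R y i) = - c p *\<^sub>R p" using split by (simp add: eq_neg_iff_add_eq_0 add.commute)
      have "Pos \<noteq> {}"
      proof
        assume "Pos = {}"
        then have "c p = 0" using eq p(1) by simp
        then obtain i where "i \<in> B" "c (y i) \<noteq> 0" using nz by blast
        then have "i \<in> Pos \<union> Neg" unfolding Pos_def Neg_def using less_linear by blast
        then show False using \<open>Pos = {}\<close> True by simp
      qed
      define s where "s = sum (\<lambda>i. c (y i)) Pos"
      have "s > 0"
        unfolding s_def using \<open>Pos \<noteq> {}\<close> sub by (intro sum_pos) (auto simp: Pos_def)
      have "(1 / s) *\<^sub>R (\<Sum>i\<in>Pos. c (y i) *\<^sub>R y i) \<in> L"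
        unfolding s_def using \<open>Pos \<noteq> {}\<close> sub(2) by (intro avg) (auto simp: Pos_def)
      then have l: "- (c p / s) *\<^sub>R p \<in> L" unfolding eq by simp
      show False
      proof (cases "c p = 0")
        case True
        then show False using l L(2) by simp
      next
        case False
        then have "c p / s > 0" using cp \<open>s > 0\<close> by simp
        then show False using p(3) l by blast
      qed
    qed
  qed
  then show thesis using B that by blast
qed

section \<open>Support estimates as functions of their parameters\<close>

lemma estimate_zero: "estimate 0 = UNIV"
  by (simp add: estimate_def)

text \<open>For a fixed \<open>w\<close>, the inequalities are homogeneous and linear in the matrix
  and the right-hand side jointly.\<close>

lemma convex_cone_estimate_params: "convex_cone {\<theta>. w \<in> estimate \<theta>}"
  by (auto simp: convex_cone_iff estimate_def matrix_vector_mult_add_rdistrib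
      scaleR_matrix_vector_assoc[symmetric] add_mono mult_left_mono)

text \<open>Closedness jointly in parameter and point yields the joint measurability required once
  the parameter depends on random samples.\<close>

lemma closed_estimate_rel: "closed {(\<theta> :: ('k::finite, 'm::finite) param, w). w \<in> estimate \<theta>}"
proof -
  have "closed {z :: ('k, 'm) param \<times> (real^'k). (fst (fst z) *v snd z) $ i \<le> snd (fst z) $ i}" for i
    unfolding matrix_vector_mult_def by (simp, intro closed_Collect_le continuous_intros)
  then have "closed (\<Inter>i. {z :: ('k, 'm) param \<times> (real^'k). (fst (fst z) *v snd z) $ i \<le> snd (fst z) $ i})"
    by (intro closed_INT) auto
  also have "(\<Inter>i. {z :: ('k, 'm) param \<times> (real^'k). (fst (fst z) *v snd z) $ i \<le> snd (fst z) $ i})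
    = {(\<theta>, w). w \<in> estimate \<theta>}"
    by (auto simp: estimate_def)
  finally show ?thesis .
qed

lemma estimate_rel_borel:
  "{(\<theta> :: ('k::finite, 'm::finite) param, w). w \<in> estimate \<theta>} \<in> sets (borel \<Otimes>\<^sub>M borel)"
  by (subst borel_prod) (rule borel_closed[OF closed_estimate_rel])

section \<open>Determining samples and random subsets of the samples\<close>

text \<open>The program is posed for exactly \<open>K\<close> samples, so the one for the samples in
  \<open>T\<close> is emulated by repeating the sample with index \<open>Min T\<close> in place of
  those outside \<open>T\<close>. The optimizer \<open>\<theta>\<close> remains feasible, the
  constraints in \<open>B\<close> already exclude anything better, and uniqueness identifies the two
  optimizers.\<close>

lemma subsample_optimizer:
  assumes "finite T" "T \<noteq> {}" "T \<subseteq> {1..K}" "unique_scenario_optimizer \<mu> D K \<omega> \<theta>"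
    and "unique_scenario_optimizer \<mu> D K (\<lambda>k\<in>{1..K}. \<omega> (if k \<in> T then k else Min T)) \<theta>'"
    and B: "B \<subseteq> T" "{\<theta>'' \<in> D. \<mu> \<theta>'' < \<mu> \<theta>} \<inter> (\<Inter>k\<in>B. {\<theta>''. \<omega> k \<in> estimate \<theta>''}) = {}"
  shows "\<theta>' = \<theta>"
proof -
  let ?\<omega> = "\<lambda>k\<in>{1..K}. \<omega> (if k \<in> T then k else Min T)"
  have "Min T \<in> T" using assms(1,2) by simp
  then have feas: "scenario_feasible D K ?\<omega> \<theta>'' \<longleftrightarrow> \<theta>'' \<in> D \<and> (\<forall>k\<in>T. \<omega> k \<in> estimate \<theta>'')" for \<theta>''
    using assms(3) unfolding scenario_feasible_def by (fastforce split: if_splits)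
  have opt: "is_arg_min \<mu> (scenario_feasible D K \<omega>) \<theta>"
    using assms(4) unfolding unique_scenario_optimizer_def by blast
  have "is_arg_min \<mu> (scenario_feasible D K ?\<omega>) \<theta>"
    unfolding is_arg_min_def feas
    using opt assms(3) B unfolding is_arg_min_def scenario_feasible_def by blast
  then show ?thesis using assms(5) unfolding unique_scenario_optimizer_def by metis
qed

text \<open>Given the samples in \<open>T\<close>, the section of \<open>A\<close> is a fixed set,
  and the samples outside \<open>T\<close> fall into it independently; Fubini's theorem then
  averages over the samples in \<open>T\<close>.\<close>

lemma outside_points_satisfied_bound:
  fixes P :: "'a measure" and A :: "(('i \<Rightarrow> 'a) \<times> 'a) set"
  assumes P: "prob_space P" and fin: "finite I" and T: "T \<subseteq> I"
    and A: "A \<in> sets (Pi\<^sub>M T (\<lambda>_. P) \<Otimes>\<^sub>M P)" and q: "0 \<le> q"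
  shows "{\<omega> \<in> space (Pi\<^sub>M I (\<lambda>_. P)). measure P (Pair (restrict \<omega> T) -` A) \<le> q
            \<and> (\<forall>i\<in>I - T. (restrict \<omega> T, \<omega> i) \<in> A)} \<in> sets (Pi\<^sub>M I (\<lambda>_. P))" (is "?E \<in> _")
    and "emeasure (Pi\<^sub>M I (\<lambda>_. P))
          {\<omega> \<in> space (Pi\<^sub>M I (\<lambda>_. P)). measure P (Pair (restrict \<omega> T) -` A) \<le> q
            \<and> (\<forall>i\<in>I - T. (restrict \<omega> T, \<omega> i) \<in> A)} \<le> ennreal (q ^ card (I - T))"
proof -
  interpret P: prob_space P by fact
  interpret product_sigma_finite "\<lambda>_. P" by unfold_locales
  interpret PT: prob_space "Pi\<^sub>M T (\<lambda>_. P)" by (intro prob_space_PiM P)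
  have finT: "finite T" using fin T finite_subset by blast
  have [measurable]: "(\<lambda>y. measure P (Pair y -` A)) \<in> borel_measurable (Pi\<^sub>M T (\<lambda>_. P))"
    using P.measurable_emeasure_Pair[OF A] unfolding measure_def by measurable
  have [measurable]: "(\<lambda>\<omega>. restrict \<omega> T) \<in> Pi\<^sub>M I (\<lambda>_. P) \<rightarrow>\<^sub>M Pi\<^sub>M T (\<lambda>_. P)"
    using T by (rule measurable_restrict_subset)
  have [measurable]: "A \<in> sets (Pi\<^sub>M T (\<lambda>_. P) \<Otimes>\<^sub>M P)" by (rule A)
  have [measurable]: "Measurable.pred (Pi\<^sub>M I (\<lambda>_. P)) (\<lambda>\<omega>. (restrict \<omega> T, \<omega> i) \<in> A)" if "i \<in> I" for i
    using that by measurable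
  have "Measurable.pred (Pi\<^sub>M I (\<lambda>_. P)) (\<lambda>\<omega>. \<forall>i\<in>I - T. (restrict \<omega> T, \<omega> i) \<in> A)"
    using fin by (intro pred_intros_finite) auto
  then show E: "?E \<in> sets (Pi\<^sub>M I (\<lambda>_. P))" by measurable
  have split: "T \<inter> (I - T) = {}" "finite T" "finite (I - T)" "T \<union> (I - T) = I"
    using fin finT T by auto
  have "emeasure (Pi\<^sub>M I (\<lambda>_. P)) ?E
    = (\<integral>\<^sup>+x. emeasure (Pi\<^sub>M (I - T) (\<lambda>_. P)) ((\<lambda>y. merge T (I - T) (x, y)) -` ?E \<inter> space (Pi\<^sub>M (I - T) (\<lambda>_. P)))
        \<partial>Pi\<^sub>M T (\<lambda>_. P))"
    using emeasure_fold_integral[OF split(1-3), of ?E] E split(4) by simp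
  also have "\<dots> \<le> (\<integral>\<^sup>+x. ennreal (q ^ card (I - T)) \<partial>Pi\<^sub>M T (\<lambda>_. P))"
  proof (intro nn_integral_mono)
    fix x assume x: "x \<in> space (Pi\<^sub>M T (\<lambda>_. P))"
    then have [simp]: "restrict x T = x" by (simp add: space_PiM PiE_restrict)
    have sec: "Pair x -` A \<in> sets P" by (rule sets_Pair1[OF A])
    let ?S = "(\<lambda>y. merge T (I - T) (x, y)) -` ?E \<inter> space (Pi\<^sub>M (I - T) (\<lambda>_. P))"
    have rm: "restrict (merge T (I - T) (x, y)) T = x" for y
      using split(1) by simp
    show "emeasure (Pi\<^sub>M (I - T) (\<lambda>_. P)) ?S \<le> ennreal (q ^ card (I - T))"
    proof (cases "measure P (Pair x -` A) \<le> q")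
      case True
      \<comment> \<open>For a fixed \<open>x\<close>, the slice of the event is contained in a box,
        whose measure is a product with one factor per outside index.\<close>
      have "?S \<subseteq> (\<Pi>\<^sub>E i\<in>I - T. Pair x -` A)"
      proof
        fix y assume y: "y \<in> ?S"
        then have "(x, merge T (I - T) (x, y) i) \<in> A" if "i \<in> I - T" for i
          using that by (simp add: rm)
        then have "(x, y i) \<in> A" if "i \<in> I - T" for i using that by (force simp: merge_def)
        then show "y \<in> (\<Pi>\<^sub>E i\<in>I - T. Pair x -` A)"
          using y by (auto simp: PiE_iff space_PiM)
      qed
      then have "emeasure (Pi\<^sub>M (I - T) (\<lambda>_. P)) ?S
          \<le> emeasure (Pi\<^sub>M (I - T) (\<lambda>_. P)) (\<Pi>\<^sub>E i\<in>I - T. Pair x -` A)"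
        using sec split by (intro emeasure_mono sets_PiM_I_finite) auto
      also have "\<dots> = (\<Prod>i\<in>I - T. emeasure P (Pair x -` A))"
        using sec split by (intro emeasure_PiM) auto
      also have "\<dots> \<le> ennreal (q ^ card (I - T))"
        using True q by (simp add: P.emeasure_eq_measure ennreal_power power_mono)
      finally show ?thesis .
    next
      case False
      then have "?S = {}" by (auto simp: rm)
      then show ?thesis by (simp only: emeasure_empty) simp
    qed
  qed
  also have "\<dots> = ennreal (q ^ card (I - T))" using PT.emeasure_space_1 by simp
  finally show "emeasure (Pi\<^sub>M I (\<lambda>_. P)) ?E \<le> ennreal (q ^ card (I - T))" .
qed

text \<open>This is \<open>cone_helly\<close> with the strictly better points of \<open>D\<close> as
  \<open>L\<close> and the optimizer itself as \<open>p\<close>. The parameter \<open>0\<close>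
  satisfies all sample constraints, so it cannot be strictly better than the optimizer.\<close>

lemma scenario_basis:
  fixes \<theta> :: "('k::finite, 'm::finite) param"
  assumes D: "convex D" "convex_on D \<mu>"
    and opt: "is_arg_min \<mu> (scenario_feasible D K \<omega>) \<theta>" and nz: "\<theta> \<noteq> 0"
  obtains B where "B \<subseteq> {1..K}" "card B < DIM(('k, 'm) param)"
    "{\<theta>' \<in> D. \<mu> \<theta>' < \<mu> \<theta>} \<inter> (\<Inter>k\<in>B. {\<theta>'. \<omega> k \<in> estimate \<theta>'}) = {}"
proof -
  let ?L = "{\<theta>' \<in> D. \<mu> \<theta>' < \<mu> \<theta>}"
  have \<theta>: "\<theta> \<in> D" "\<And>k. k \<in> {1..K} \<Longrightarrow> \<omega> k \<in> estimate \<theta>"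
    and min: "\<And>\<theta>'. scenario_feasible D K \<omega> \<theta>' \<Longrightarrow> \<not> \<mu> \<theta>' < \<mu> \<theta>"
    using opt unfolding is_arg_min_def scenario_feasible_def by blast+
  have zero: "0 \<notin> ?L"
    using min[of 0] by (auto simp: scenario_feasible_def estimate_zero)
  have L: "convex ?L"
  proof (rule convexI)
    fix x y and u v :: real
    assume *: "x \<in> ?L" "y \<in> ?L" "0 \<le> u" "0 \<le> v" "u + v = 1"
    then have u: "u = 1 - v" by simp
    have "\<mu> (u *\<^sub>R x + v *\<^sub>R y) \<le> u * \<mu> x + v * \<mu> y"
      using convex_onD[OF D(2), of v x y] * unfolding u by auto
    also have "\<dots> < \<mu> \<theta>" using * by (intro convex_bound_lt) auto
    finally show "u *\<^sub>R x + v *\<^sub>R y \<in> ?L" using * convexD[OF D(1)] by auto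
  qed
  have neg: "- r *\<^sub>R \<theta> \<notin> ?L" if "r > 0" for r
  proof
    assume l: "- r *\<^sub>R \<theta> \<in> ?L"
    \<comment> \<open>The weight for which the convex combination of
      \<open>- r *\<^sub>R \<theta>\<close> and \<open>\<theta>\<close> is \<open>0\<close>. By
      convexity \<open>0\<close> would then belong to \<open>D\<close> and be strictly better than
      \<open>\<theta>\<close>.\<close>
    define t where "t = r / (1 + r)"
    have t: "0 \<le> t" "t < 1" using that by (auto simp: t_def)
    have "(1 - t) * r = t" using that by (simp add: t_def field_simps)
    then have "(1 - t) *\<^sub>R (- r *\<^sub>R \<theta>) + t *\<^sub>R \<theta> = 0" by simp
    then have "0 \<in> D" "\<mu> 0 \<le> (1 - t) * \<mu> (- r *\<^sub>R \<theta>) + t * \<mu> \<theta>"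
      using convexD_alt[OF D(1), of "- r *\<^sub>R \<theta>" \<theta> t] convex_onD[OF D(2), of t "- r *\<^sub>R \<theta>" \<theta>] l \<theta>(1) t
      by auto
    moreover have "(1 - t) * \<mu> (- r *\<^sub>R \<theta>) < (1 - t) * \<mu> \<theta>" using l t by simp
    then have "(1 - t) * \<mu> (- r *\<^sub>R \<theta>) + t * \<mu> \<theta> < \<mu> \<theta>" by (simp add: algebra_simps)
    ultimately show False using zero by auto
  qed
  have "?L \<inter> (\<Inter>k\<in>{1..K}. {\<theta>'. \<omega> k \<in> estimate \<theta>'}) = {}"
    using min unfolding scenario_feasible_def by blast
  moreover have "\<theta> \<in> (\<Inter>k\<in>{1..K}. {\<theta>'. \<omega> k \<in> estimate \<theta>'})" using \<theta>(2) by simp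
  ultimately show thesis
    using cone_helly[of "{1..K}" "\<lambda>k. {\<theta>'. \<omega> k \<in> estimate \<theta>'}" ?L \<theta>]
      convex_cone_estimate_params L zero nz neg that by blast
qed

text \<open>The complement of the support is the union of the open null sets; by the Lindelof
  property countably many of them suffice.\<close>

lemma AE_measure_support:
  fixes P :: "'a::second_countable_topology measure"
  assumes "sets P = sets borel"
  shows "AE x in P. x \<in> measure_support P"
proof -
  let ?F = "{U. open U \<and> emeasure P U = 0}"
  obtain F' where F': "F' \<subseteq> ?F" "countable F'" "\<Union>F' = \<Union>?F"
    using Lindelof[of ?F] by auto
  have "(\<Union>U\<in>F'. U) \<in> null_sets P"
    using F'(1) assms by (intro null_sets_UN' F'(2)) (auto simp: null_sets_def)
  moreover have "{x \<in> space P. x \<notin> measure_support P} \<subseteq> (\<Union>U\<in>F'. U)"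
    using F'(3) by (auto simp: measure_support_def)
  ultimately show ?thesis by (rule AE_I')
qed

text \<open>Both sides are the probability that a random subset, keeping each element of
  \<open>I\<close> independently with probability \<open>p\<close>, contains \<open>B\<close>. The
  proof expands a product over \<open>I\<close> in which the weight of dropping an element of
  \<open>B\<close> is set to \<open>0\<close>.\<close>

lemma sum_thinned_supersets:
  fixes p :: real
  assumes "finite I" "B \<subseteq> I"
  shows "(\<Sum>T | B \<subseteq> T \<and> T \<subseteq> I. p ^ card T * (1 - p) ^ card (I - T)) = p ^ card B"
proof -
  let ?f = "\<lambda>i. if i \<in> B then 0 else 1 - p"
  have fin: "finite B" using assms finite_subset by blast
  have *: "(\<Prod>i\<in>I - T. ?f i) = (if B \<subseteq> T then (1 - p) ^ card (I - T) else 0)" if "T \<subseteq> I" for T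
  proof (cases "B \<subseteq> T")
    case True
    then have "(\<Prod>i\<in>I - T. ?f i) = (\<Prod>i\<in>I - T. 1 - p)" by (intro prod.cong) auto
    then show ?thesis using True by simp
  next
    case False
    then show ?thesis using assms by (auto simp: prod_zero_iff split: if_splits)
  qed
  have "p ^ card B = (\<Prod>i\<in>I. if i \<in> B then p else 1)"
    using assms by (simp add: prod.If_cases Int_absorb1)
  also have "\<dots> = (\<Prod>i\<in>I. p + ?f i)" by (intro prod.cong) auto
  also have "\<dots> = (\<Sum>T\<in>Pow I. (\<Prod>i\<in>T. p) * (\<Prod>i\<in>I - T. ?f i))" by (rule prod_add[OF assms(1)])
  also have "\<dots> = (\<Sum>T\<in>Pow I. if B \<subseteq> T then p ^ card T * (1 - p) ^ card (I - T) else 0)"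
    by (intro sum.cong) (auto simp: *)
  also have "\<dots> = (\<Sum>T\<in>{T\<in>Pow I. B \<subseteq> T}. p ^ card T * (1 - p) ^ card (I - T))"
    using assms(1) by (intro sum.inter_filter[symmetric]) simp
  also have "{T\<in>Pow I. B \<subseteq> T} = {T. B \<subseteq> T \<and> T \<subseteq> I}" by auto
  finally show ?thesis by simp
qed

section \<open>Tail bound and sample size for the scenario program\<close>

text \<open>The random thinning is not modelled as a measure: \<open>g\<close> averages the
  indicators of the events \<open>E T\<close> over the subsets \<open>T\<close> with the thinning
  weights \<open>c T\<close>. It is at least a fixed power of \<open>p\<close> where the violation
  is large, its integral is small, and Markov's inequality compares the two.\<close>

lemma scenario_violation_bound:
  fixes P :: "(real^'k::finite) measure" and D :: "('k, 'm::finite) param set"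
    and \<theta> :: "(nat \<Rightarrow> real^'k) \<Rightarrow> ('k, 'm) param"
    and K :: nat and p \<epsilon> :: real
  defines "M \<equiv> \<Pi>\<^sub>M k\<in>{1..K}. P"
  assumes P: "prob_space P" "sets P = sets borel"
    and D: "convex D" "convex_on D \<mu>"
    and opt: "\<And>\<omega>. \<omega> \<in> {1..K} \<rightarrow>\<^sub>E measure_support P \<Longrightarrow> unique_scenario_optimizer \<mu> D K \<omega> (\<theta> \<omega>)"
    and \<theta>[measurable]: "\<theta> \<in> borel_measurable M"
    and K: "1 \<le> K" and p: "0 < p" "p \<le> 1" and \<epsilon>: "0 \<le> \<epsilon>" "\<epsilon> \<le> 1"
  shows "outer_measure_of M {\<omega> \<in> space M. \<omega> \<in> {1..K} \<rightarrow>\<^sub>E measure_support P \<longrightarrow>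
           measure P (- estimate (\<theta> \<omega>)) > \<epsilon>}
         \<le> ennreal ((1 - (1 - p) * \<epsilon>) ^ K / p ^ (DIM(('k, 'm) param) - 1))"
proof -
  interpret P: prob_space P by fact
  have [measurable_cong]: "sets P = sets borel" by fact
  have spP: "space P = UNIV" using sets_eq_imp_space_eq[OF P(2)] by simp
  let ?I = "{1..K}" and ?d = "DIM(('k, 'm) param) - 1"
  define R where "R T \<omega> = (\<lambda>k\<in>?I. \<omega> (if k \<in> T then k else Min T))" for T and \<omega> :: "nat \<Rightarrow> real^'k"
  define A where "A T = {(x, w) \<in> space (Pi\<^sub>M T (\<lambda>_. P) \<Otimes>\<^sub>M P). w \<in> estimate (\<theta> (R T x))}" for T
  \<comment> \<open>The estimate computed from the samples in \<open>T\<close> misses probability at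
    least \<open>\<epsilon>\<close> and nevertheless contains all other samples.\<close>
  define E where "E T = {\<omega> \<in> space M. measure P (Pair (restrict \<omega> T) -` A T) \<le> 1 - \<epsilon>
      \<and> (\<forall>i\<in>?I - T. (restrict \<omega> T, \<omega> i) \<in> A T)}" for T
  define c where "c T = p ^ card T * (1 - p) ^ card (?I - T)" for T
  \<comment> \<open>The empty set is left out because the padding in \<open>R\<close> uses
    \<open>Min T\<close>.\<close>
  define TT where "TT = {T. T \<noteq> {} \<and> T \<subseteq> ?I}"
  define g where "g \<omega> = (\<Sum>T\<in>TT. c T * indicator (E T) \<omega>)" for \<omega>
  have TT: "finite TT" "\<And>T. T \<in> TT \<Longrightarrow> T \<subseteq> ?I \<and> finite T \<and> T \<noteq> {} \<and> Min T \<in> T"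
    unfolding TT_def using finite_subset[OF _ finite_atLeastAtMost] Min_in by auto
  have c: "c T \<ge> 0" for T using p by (simp add: c_def)
  have A: "A T \<in> sets (Pi\<^sub>M T (\<lambda>_. P) \<Otimes>\<^sub>M P)" if "T \<in> TT" for T
  proof -
    have "(\<lambda>x. x (if k \<in> T then k else Min T)) \<in> Pi\<^sub>M T (\<lambda>_. P) \<rightarrow>\<^sub>M P" for k
      using TT(2)[OF that] by (intro measurable_component_singleton) auto
    then have [measurable]: "R T \<in> Pi\<^sub>M T (\<lambda>_. P) \<rightarrow>\<^sub>M M"
      unfolding R_def M_def by (intro measurable_restrict)
    have "(\<lambda>(x, w). (\<theta> (R T x), w)) \<in> Pi\<^sub>M T (\<lambda>_. P) \<Otimes>\<^sub>M P \<rightarrow>\<^sub>M borel \<Otimes>\<^sub>M borel"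
      by measurable
    from measurable_sets[OF this estimate_rel_borel] show ?thesis
      by (simp add: A_def vimage_def Int_def conj_commute case_prod_beta')
  qed
  have E: "E T \<in> sets M" "emeasure M (E T) \<le> ennreal ((1 - \<epsilon>) ^ card (?I - T))" if "T \<in> TT" for T
    using outside_points_satisfied_bound[OF P(1) _ _ A[OF that], of ?I "1 - \<epsilon>"] TT(2)[OF that] \<epsilon>
    unfolding E_def M_def by auto
  have main: "p ^ ?d \<le> g \<omega>"
    if sp: "\<omega> \<in> space M" and supp: "\<omega> \<in> ?I \<rightarrow>\<^sub>E measure_support P"
      and viol: "measure P (- estimate (\<theta> \<omega>)) > \<epsilon>" for \<omega>
  proof -
    have "\<theta> \<omega> \<noteq> 0" using viol \<epsilon> by (auto simp: estimate_zero)
    moreover have min: "is_arg_min \<mu> (scenario_feasible D K \<omega>) (\<theta> \<omega>)"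
      using opt[OF supp] unfolding unique_scenario_optimizer_def by blast
    ultimately obtain B0 where B0: "B0 \<subseteq> ?I" "card B0 < DIM(('k, 'm) param)"
      "{\<theta>' \<in> D. \<mu> \<theta>' < \<mu> (\<theta> \<omega>)} \<inter> (\<Inter>k\<in>B0. {\<theta>'. \<omega> k \<in> estimate \<theta>'}) = {}"
      using scenario_basis[OF D] by blast
    \<comment> \<open>Enlarging an empty \<open>B0\<close> to one sample keeps the supersets of
      \<open>B\<close> inside \<open>TT\<close>; the cardinality bound survives because
      \<open>?d\<close> is at least \<open>1\<close>.\<close>
    define B where "B = (if B0 = {} then {1} else B0)"
    have "1 \<le> ?d" using DIM_positive[where 'a = "real^'k^'m"] DIM_positive[where 'a = "real^'m"]
      unfolding DIM_prod by linarith
    then have B: "B \<subseteq> ?I" "B \<noteq> {}" "card B \<le> ?d"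
      "{\<theta>' \<in> D. \<mu> \<theta>' < \<mu> (\<theta> \<omega>)} \<inter> (\<Inter>k\<in>B. {\<theta>'. \<omega> k \<in> estimate \<theta>'}) = {}"
      using B0 K by (auto simp: B_def)
    have mem: "\<omega> \<in> E T" if T: "B \<subseteq> T" "T \<subseteq> ?I" for T
    proof -
      have T': "T \<in> TT" using T B(2) by (auto simp: TT_def)
      have fT: "finite T" "T \<noteq> {}" "Min T \<in> T" using TT(2)[OF T'] by auto
      \<comment> \<open>The padded sequence reads only coordinates in \<open>T\<close>, so the
        optimizer for it is determined by those samples.\<close>
      have Rr: "R T (restrict \<omega> T) = R T \<omega>" using fT by (auto simp: R_def fun_eq_iff)
      have "R T \<omega> \<in> ?I \<rightarrow>\<^sub>E measure_support P"
      proof (rule PiE_I)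
        fix k assume "k \<in> ?I"
        moreover have "Min T \<in> ?I" using fT(3) T(2) by blast
        ultimately show "R T \<omega> k \<in> measure_support P"
          using PiE_mem[OF supp, of k] PiE_mem[OF supp, of "Min T"] by (simp add: R_def)
      qed (auto simp: R_def)
      from subsample_optimizer[OF fT(1,2) T(2) opt[OF supp] opt[OF this, unfolded R_def] T(1) B(4)]
      have "\<theta> (R T \<omega>) = \<theta> \<omega>" by (simp add: R_def)
      moreover have rsp: "restrict \<omega> T \<in> space (Pi\<^sub>M T (\<lambda>_. P))"
        by (auto simp: space_PiM spP)
      ultimately have A_iff: "(restrict \<omega> T, w) \<in> A T \<longleftrightarrow> w \<in> estimate (\<theta> \<omega>)" for w
        by (simp add: A_def Rr space_pair_measure spP)
      then have sec: "Pair (restrict \<omega> T) -` A T = estimate (\<theta> \<omega>)" by auto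
      then have "estimate (\<theta> \<omega>) \<in> sets P" using sets_Pair1[OF A[OF T']] by metis
      then have "measure P (estimate (\<theta> \<omega>)) = 1 - measure P (- estimate (\<theta> \<omega>))"
        using P.prob_compl[of "estimate (\<theta> \<omega>)"] by (simp add: spP Compl_eq_Diff_UNIV)
      moreover have "\<omega> k \<in> estimate (\<theta> \<omega>)" if "k \<in> ?I" for k
        using min that unfolding is_arg_min_def scenario_feasible_def by blast
      ultimately show ?thesis using viol sp by (auto simp: E_def sec A_iff)
    qed
    have "p ^ ?d \<le> p ^ card B" using B(3) p by (intro power_decreasing) auto
    also have "\<dots> = (\<Sum>T | B \<subseteq> T \<and> T \<subseteq> ?I. c T)"
      unfolding c_def using sum_thinned_supersets[of ?I B p] B(1) by simp
    also have "\<dots> = (\<Sum>T | B \<subseteq> T \<and> T \<subseteq> ?I. c T * indicator (E T) \<omega>)"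
      using mem by (intro sum.cong) auto
    also have "\<dots> \<le> g \<omega>"
      unfolding g_def using TT(1) c B(2) by (intro sum_mono2) (auto simp: TT_def)
    finally show ?thesis .
  qed
  \<comment> \<open>Together with a null set, \<open>G\<close> is a measurable cover of the event
    whose outer measure is bounded.\<close>
  define G where "G = {\<omega> \<in> space M. p ^ ?d \<le> g \<omega>}"
  have [measurable]: "g \<in> borel_measurable M"
    unfolding g_def using E(1) by (intro borel_measurable_sum) auto
  have G: "G \<in> sets M" unfolding G_def by measurable
  have "emeasure M G \<le> ennreal (1 / p ^ ?d) * (\<integral>\<^sup>+\<omega>. ennreal (g \<omega>) * indicator (space M) \<omega> \<partial>M)"
  proof -
    have "1 \<le> ennreal (1 / p ^ ?d) * ennreal (g \<omega>)" if "p ^ ?d \<le> g \<omega>" for \<omega>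
    proof -
      have "1 \<le> 1 / p ^ ?d * g \<omega>" using that p by (simp add: field_simps del: DIM_cart DIM_prod)
      then have "ennreal 1 \<le> ennreal (1 / p ^ ?d * g \<omega>)" by (rule ennreal_leI)
      also have "\<dots> = ennreal (1 / p ^ ?d) * ennreal (g \<omega>)" using p by (intro ennreal_mult') simp
      finally show ?thesis by simp
    qed
    then have "G \<subseteq> {\<omega> \<in> space M. 1 \<le> ennreal (1 / p ^ ?d) * ennreal (g \<omega>)}"
      by (auto simp: G_def simp del: DIM_cart DIM_prod)
    then have "emeasure M G \<le> emeasure M {\<omega> \<in> space M. 1 \<le> ennreal (1 / p ^ ?d) * ennreal (g \<omega>)}"
      by (intro emeasure_mono) measurable
    also have "\<dots> \<le> ennreal (1 / p ^ ?d) * (\<integral>\<^sup>+\<omega>. ennreal (g \<omega>) * indicator (space M) \<omega> \<partial>M)"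
      by (intro nn_integral_Markov_inequality) auto
    finally show ?thesis .
  qed
  also have "(\<integral>\<^sup>+\<omega>. ennreal (g \<omega>) * indicator (space M) \<omega> \<partial>M) = (\<integral>\<^sup>+\<omega>. (\<Sum>T\<in>TT. ennreal (c T) * indicator (E T) \<omega>) \<partial>M)"
    unfolding g_def using c
    by (intro nn_integral_cong) (simp add: ennreal_mult' ennreal_indicator flip: sum_ennreal)
  also have "\<dots> = (\<Sum>T\<in>TT. ennreal (c T) * emeasure M (E T))"
    using E(1) by (subst nn_integral_sum) (auto simp: nn_integral_cmult_indicator)
  also have "\<dots> \<le> (\<Sum>T\<in>TT. ennreal (c T) * ennreal ((1 - \<epsilon>) ^ card (?I - T)))"
    using E(2) by (intro sum_mono mult_left_mono) auto
  also have "\<dots> = ennreal (\<Sum>T\<in>TT. c T * (1 - \<epsilon>) ^ card (?I - T))"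
    using c \<epsilon> by (simp add: sum_ennreal flip: ennreal_mult)
  \<comment> \<open>The term of the empty set is added back to complete the product expansion, whose
    factors are \<open>p + (1 - p) * (1 - \<epsilon>)\<close>.\<close>
  also have "\<dots> \<le> ennreal (\<Sum>T\<in>Pow ?I. c T * (1 - \<epsilon>) ^ card (?I - T))"
    using c \<epsilon> by (intro ennreal_leI sum_mono2) (auto simp: TT_def)
  also have "(\<Sum>T\<in>Pow ?I. c T * (1 - \<epsilon>) ^ card (?I - T))
      = (\<Sum>T\<in>Pow ?I. (\<Prod>i\<in>T. p) * (\<Prod>i\<in>?I - T. (1 - p) * (1 - \<epsilon>)))"
    by (simp add: c_def power_mult_distrib mult.assoc)
  also have "\<dots> = (1 - (1 - p) * \<epsilon>) ^ K"
    by (subst prod_add[symmetric]) (simp_all add: algebra_simps)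
  finally have G_le: "emeasure M G \<le> ennreal ((1 - (1 - p) * \<epsilon>) ^ K / p ^ ?d)"
    using p by (simp add: mult_left_mono flip: ennreal_mult')
  \<comment> \<open>Sample sequences that leave the support, where optimality is not assumed, form a
    null set.\<close>
  have "AE \<omega> in M. \<forall>k\<in>?I. \<omega> k \<in> measure_support P"
    unfolding M_def
    by (intro AE_finite_allI AE_PiM_component P(1) AE_measure_support P(2)) auto
  then obtain N where N: "N \<in> null_sets M" "{\<omega> \<in> space M. \<not> (\<forall>k\<in>?I. \<omega> k \<in> measure_support P)} \<subseteq> N"
    by (auto elim!: AE_E2 simp: eventually_ae_filter)
  have "{\<omega> \<in> space M. \<omega> \<in> ?I \<rightarrow>\<^sub>E measure_support P \<longrightarrow> measure P (- estimate (\<theta> \<omega>)) > \<epsilon>} \<subseteq> G \<union> N"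
    using main N(2) by (auto simp: G_def M_def space_PiM PiE_iff)
  then have "outer_measure_of M {\<omega> \<in> space M. \<omega> \<in> ?I \<rightarrow>\<^sub>E measure_support P \<longrightarrow>
      measure P (- estimate (\<theta> \<omega>)) > \<epsilon>} \<le> outer_measure_of M (G \<union> N)"
    by (rule outer_measure_of_mono)
  also have "\<dots> = emeasure M G"
    using G N(1) by (subst outer_measure_of_eq) (auto simp: emeasure_Un_null_set)
  finally show ?thesis using G_le by (rule order.trans)
qed

text \<open>By \<open>1 - x \<le> exp (- x)\<close> the left side is at most
  \<open>exp (d - x * K)\<close> with \<open>x = (1 - exp (- 1)) * \<epsilon>\<close>, and the
  sample size is what makes this at most \<open>\<beta>\<close>. Here \<open>exp (- 1)\<close> is
  the keeping probability \<open>p\<close>, so each determining sample costs exactly one unit in the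
  exponent.\<close>

lemma scenario_sample_size:
  fixes \<epsilon> \<beta> :: real and K d :: nat
  assumes "0 < \<epsilon>" "\<epsilon> < 1" "0 < \<beta>"
    and size: "real K \<ge> exp 1 / (exp 1 - 1) * (1 / \<epsilon>) * (ln (1 / \<beta>) + real d)"
  shows "(1 - (1 - exp (- 1)) * \<epsilon>) ^ K / exp (- 1) ^ d \<le> \<beta>"
proof -
  define x where "x = (1 - exp (- 1 :: real)) * \<epsilon>"
  have e: "exp (1 :: real) > 1" by simp
  have x: "x = (exp 1 - 1) / exp 1 * \<epsilon>" by (simp add: x_def exp_minus field_simps)
  have "x > 0" using e assms(1) by (simp add: x)
  have "x \<le> 1 * 1" unfolding x_def using assms(1,2) by (intro mult_mono) auto
  have "exp 1 / (exp 1 - 1) * (1 / \<epsilon>) = 1 / x" using e by (simp add: x)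
  then have "(ln (1 / \<beta>) + real d) / x \<le> real K" using size by simp
  then have K: "real d - x * real K \<le> ln \<beta>"
    using \<open>x > 0\<close> assms(3) by (simp add: pos_divide_le_eq ln_div mult.commute)
  have "(1 - x) ^ K / exp (- 1) ^ d \<le> exp (- x) ^ K / exp (- 1) ^ d"
    using \<open>x \<le> 1 * 1\<close> exp_ge_add_one_self[of "- x"] by (intro divide_right_mono power_mono) auto
  also have "\<dots> = exp (real d - x * real K)"
    by (simp add: exp_diff exp_minus field_simps flip: exp_of_nat_mult)
  also have "\<dots> \<le> \<beta>" using K assms(3) by (simp add: ln_ge_iff)
  finally show ?thesis by (simp add: x_def)
qed

section \<open>The robust program on the estimated support\<close>

text \<open>Whichever cell containing \<open>w\<close> the policy selects, the robust constraint
  holds on all of that cell, and the recourse value of the same cell is the witness.\<close>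

lemma rp_feasible_policy:
  assumes feas: "rp_feasible Bin C (gamma_phi Fx Fd f a BB cc) (gamma_s Sx Su s a BB) \<H> (H, \<delta>)"
    and w: "w \<in> (\<Union>i. C i)"
  shows "\<exists>\<delta>'\<in>recourse Bin. \<forall>j. (Fx *v (a + BB *v policy C H w + cc w) + Fd *v \<delta>' + f w) $ j \<le> 0"
    and "\<forall>j. (Sx *v (a + BB *v policy C H w) + Su *v policy C H w + s w) $ j \<le> 0"
proof -
  define i where "i = (SOME i. w \<in> C i)"
  have i: "w \<in> C i" unfolding i_def using w by (auto intro: someI)
  have u: "policy C H w = H $ i *v aug w" using w by (auto simp: policy_def i_def)
  let ?g = "\<lambda>i w. max (MAX j. gamma_phi Fx Fd f a BB cc (H $ i) (\<delta> $ i) w $ j)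
    (MAX j. gamma_s Sx Su s a BB (H $ i) w $ j)"
  have "ereal (?g i w) \<le> (SUP i. SUP w\<in>C i. ereal (?g i w))"
    by (intro SUP_upper2[of i] SUP_upper2[of w] i) auto
  also have "\<dots> \<le> 0" using feas by (simp add: rp_feasible_def)
  finally have "?g i w \<le> 0" by (simp add: zero_ereal_def)
  then have le: "gamma_phi Fx Fd f a BB cc (H $ i) (\<delta> $ i) w $ j \<le> 0"
    "gamma_s Sx Su s a BB (H $ i) w $ j' \<le> 0" for j j'
    by simp_all
  have "\<delta> $ i \<in> recourse Bin" using feas by (simp add: rp_feasible_def)
  moreover have "Fx *v (a + BB *v policy C H w + cc w) + Fd *v (\<delta> $ i) + f w
      = gamma_phi Fx Fd f a BB cc (H $ i) (\<delta> $ i) w"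
    by (simp add: gamma_phi_def u matrix_vector_right_distrib)
  ultimately show "\<exists>\<delta>'\<in>recourse Bin. \<forall>j.
      (Fx *v (a + BB *v policy C H w + cc w) + Fd *v \<delta>' + f w) $ j \<le> 0"
    using le(1) by metis
  show "\<forall>j. (Sx *v (a + BB *v policy C H w) + Su *v policy C H w + s w) $ j \<le> 0"
    using le(2) by (simp add: gamma_s_def u)
qed

theorem theorem4p10:
  fixes N Kw :: nat
    and step :: "'t::finite \<Rightarrow> nat"
    and A :: "real^'nx::finite^'nx" and B :: "real^'nu::finite^'nx"
    and c :: "real^'nw::finite \<Rightarrow> real^'nx" and x0 :: "real^'nx"
    and P :: "(real^('t \<times> 'nw)) measure"
    and Fx :: "real^('t \<times> 'nx)^'q::finite" and Fd :: "real^'d::finite^'q" and Bin :: "'d set"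
    and f :: "real^('t \<times> 'nw) \<Rightarrow> real^'q"
    and Sx :: "real^('t \<times> 'nx)^'r::finite" and Su :: "real^('t \<times> 'nu)^'r"
    and s :: "real^('t \<times> 'nw) \<Rightarrow> real^'r"
    and \<mu> :: "('t \<times> 'nw, 'm::finite) param \<Rightarrow> real"
    and D :: "(('t \<times> 'nw, 'm) param) set"
    and \<theta> :: "(nat \<Rightarrow> real^('t \<times> 'nw)) \<Rightarrow> ('t \<times> 'nw, 'm) param"
    and C :: "(nat \<Rightarrow> real^('t \<times> 'nw)) \<Rightarrow> 'p::finite \<Rightarrow> (real^('t \<times> 'nw)) set"
    and \<H> :: "(nat \<Rightarrow> real^('t \<times> 'nw)) \<Rightarrow> ((('t, 'nu, 'nw) gain)^'p) set"
    and J :: "(('t, 'nu, 'nw) gain)^'p \<Rightarrow> real"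
    and Hopt :: "(nat \<Rightarrow> real^('t \<times> 'nw)) \<Rightarrow> (('t, 'nu, 'nw) gain)^'p"
    and \<delta>opt :: "(nat \<Rightarrow> real^('t \<times> 'nw)) \<Rightarrow> (real^'d)^'p"
    and \<epsilon> \<beta> :: real
  assumes horizon: "bij_betw step UNIV {0..N}"
    and affine: "affine_map c" "affine_map f" "affine_map s"
    and distribution: "prob_space P" "sets P = sets borel"
    and size_convex: "convex D" "convex_on D \<mu>"
    and estimate_optimal: "\<And>\<omega>. \<omega> \<in> {1..Kw} \<rightarrow>\<^sub>E measure_support P \<Longrightarrow>
          unique_scenario_optimizer \<mu> D Kw \<omega> (\<theta> \<omega>)"
    and estimate_random: "\<theta> \<in> borel_measurable (\<Pi>\<^sub>M k\<in>{1..Kw}. P)"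
    and partition: "\<And>\<omega>. \<omega> \<in> {1..Kw} \<rightarrow>\<^sub>E measure_support P \<Longrightarrow>
          polyhedral_partition (estimate (\<theta> \<omega>)) (C \<omega>)"
    and policies: "\<And>\<omega>. \<omega> \<in> {1..Kw} \<rightarrow>\<^sub>E measure_support P \<Longrightarrow> polyhedron (\<H> \<omega>)"
          "\<And>\<omega> H. \<omega> \<in> {1..Kw} \<rightarrow>\<^sub>E measure_support P \<Longrightarrow> H \<in> \<H> \<omega> \<Longrightarrow>
            causal_on step (estimate (\<theta> \<omega>)) (policy (C \<omega>) H)"
    and cost: "linear_or_convex_quadratic J"
    and rp_optimal: "\<And>\<omega>. \<omega> \<in> {1..Kw} \<rightarrow>\<^sub>E measure_support P \<Longrightarrow>
          is_arg_min (\<lambda>(H, \<delta>). J H)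
            (rp_feasible Bin (C \<omega>)
              (gamma_phi Fx Fd f (bigA step A *v x0) (bigB step A B) (bigc step A c))
              (gamma_s Sx Su s (bigA step A *v x0) (bigB step A B))
              (\<H> \<omega>))
            (Hopt \<omega>, \<delta>opt \<omega>)"
    and parameters: "0 < \<epsilon>" "\<epsilon> < 1" "0 < \<beta>" "\<beta> < 1"
    and sample_size: "real Kw \<ge> exp 1 / (exp 1 - 1) * (1 / \<epsilon>) *
          (ln (1 / \<beta>) + real CARD('m) * (real N + 1) * real CARD('nw) + real CARD('m) - 1)"
  shows "outer_measure_of (\<Pi>\<^sub>M k\<in>{1..Kw}. P)
           {\<omega> \<in> space (\<Pi>\<^sub>M k\<in>{1..Kw}. P).
             V_phi P Bin Fx Fd f (bigA step A *v x0) (bigB step A B) (bigc step A c)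
               (policy (C \<omega>) (Hopt \<omega>)) > \<epsilon>} \<le> ennreal \<beta>
       \<and> outer_measure_of (\<Pi>\<^sub>M k\<in>{1..Kw}. P)
           {\<omega> \<in> space (\<Pi>\<^sub>M k\<in>{1..Kw}. P).
             V_s P Sx Su s (bigA step A *v x0) (bigB step A B)
               (policy (C \<omega>) (Hopt \<omega>)) > \<epsilon>} \<le> ennreal \<beta>"
proof -
  let ?a = "bigA step A *v x0" and ?BB = "bigB step A B" and ?cc = "bigc step A c"
  let ?M = "\<Pi>\<^sub>M k\<in>{1..Kw}. P" and ?d = "DIM(('t \<times> 'nw, 'm) param) - 1"
  let ?u = "\<lambda>\<omega>. policy (C \<omega>) (Hopt \<omega>)"
  have card_t: "CARD('t) = N + 1" using bij_betw_same_card[OF horizon] by simp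
  \<comment> \<open>The parameters consist of a matrix and a vector with \<open>CARD('m)\<close>
    rows; one is added to avoid truncated subtraction of naturals.\<close>
  have "?d + 1 = CARD('m) * ((N + 1) * CARD('nw)) + CARD('m)"
    using card_t DIM_positive[where 'a = "('t \<times> 'nw, 'm) param"] by simp
  then have "real (?d + 1) = real (CARD('m) * ((N + 1) * CARD('nw)) + CARD('m))" by (rule arg_cong)
  then have d: "real ?d = real CARD('m) * (real N + 1) * real CARD('nw) + real CARD('m) - 1"
    by (simp add: algebra_simps del: DIM_cart DIM_prod)
  have size: "real Kw \<ge> exp 1 / (exp 1 - 1) * (1 / \<epsilon>) * (ln (1 / \<beta>) + real ?d)"
    using sample_size unfolding d by (simp add: algebra_simps)
  have tail: "(1 - (1 - exp (- 1)) * \<epsilon>) ^ Kw / exp (- 1) ^ ?d \<le> \<beta>"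
    using scenario_sample_size[OF parameters(1-3) size] .
  have "0 < exp 1 / (exp 1 - 1) * (1 / \<epsilon>) * (ln (1 / \<beta>) + real ?d)"
    using parameters by (intro mult_pos_pos add_pos_nonneg) auto
  then have "1 \<le> Kw" using size by (cases Kw) auto
  \<comment> \<open>Both claims reduce to bounding the violation by the mass outside the estimate.
    Sequences leaving the support belong to the larger set vacuously, so \<open>V\<close> has to be
    controlled only on the support.\<close>
  have bound: "outer_measure_of ?M {\<omega> \<in> space ?M. V \<omega> > \<epsilon>} \<le> ennreal \<beta>"
    if V: "\<And>\<omega>. \<omega> \<in> {1..Kw} \<rightarrow>\<^sub>E measure_support P \<Longrightarrow> V \<omega> \<le> measure P (- estimate (\<theta> \<omega>))" for V
  proof -
    have "outer_measure_of ?M {\<omega> \<in> space ?M. V \<omega> > \<epsilon>}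
        \<le> outer_measure_of ?M {\<omega> \<in> space ?M. \<omega> \<in> {1..Kw} \<rightarrow>\<^sub>E measure_support P \<longrightarrow>
            measure P (- estimate (\<theta> \<omega>)) > \<epsilon>}"
      using V by (intro outer_measure_of_mono) (auto intro: less_le_trans)
    also have "\<dots> \<le> ennreal ((1 - (1 - exp (- 1)) * \<epsilon>) ^ Kw / exp (- 1) ^ ?d)"
      using parameters \<open>1 \<le> Kw\<close>
      by (intro scenario_violation_bound[OF distribution size_convex estimate_optimal estimate_random]) auto
    also have "\<dots> \<le> ennreal \<beta>" using tail by (rule ennreal_leI)
    finally show ?thesis .
  qed
  have "V_phi P Bin Fx Fd f ?a ?BB ?cc (?u \<omega>) \<le> measure P (- estimate (\<theta> \<omega>))"
    and "V_s P Sx Su s ?a ?BB (?u \<omega>) \<le> measure P (- estimate (\<theta> \<omega>))"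
    if \<omega>: "\<omega> \<in> {1..Kw} \<rightarrow>\<^sub>E measure_support P" for \<omega>
  proof -
    interpret prob_space P by fact
    have "(\<Union>i. C \<omega> i) = estimate (\<theta> \<omega>)"
      using partition[OF \<omega>] by (simp add: polyhedral_partition_def)
    moreover have "rp_feasible Bin (C \<omega>) (gamma_phi Fx Fd f ?a ?BB ?cc) (gamma_s Sx Su s ?a ?BB)
        (\<H> \<omega>) (Hopt \<omega>, \<delta>opt \<omega>)"
      using rp_optimal[OF \<omega>] by (simp add: is_arg_min_def)
    ultimately have sat: "\<exists>\<delta>\<in>recourse Bin. \<forall>j. (Fx *v (?a + ?BB *v ?u \<omega> w + ?cc w) + Fd *v \<delta> + f w) $ j \<le> 0"
      "\<forall>j. (Sx *v (?a + ?BB *v ?u \<omega> w) + Su *v ?u \<omega> w + s w) $ j \<le> 0"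
      if "w \<in> estimate (\<theta> \<omega>)" for w
      using rp_feasible_policy[of Bin "C \<omega>" Fx Fd f ?a ?BB ?cc Sx Su s "\<H> \<omega>" "Hopt \<omega>" "\<delta>opt \<omega>" w] that
      by auto
    have "estimate (\<theta> \<omega>) \<in> sets borel"
      using measurable_sets[OF measurable_Pair1' estimate_rel_borel, of "\<theta> \<omega>"] by (simp add: vimage_def)
    then have meas: "- estimate (\<theta> \<omega>) \<in> sets P" using distribution(2) by simp
    show "V_phi P Bin Fx Fd f ?a ?BB ?cc (?u \<omega>) \<le> measure P (- estimate (\<theta> \<omega>))"
      unfolding V_phi_def
    proof (intro finite_measure_mono meas subsetI ComplI)
      fix w assume w: "w \<in> {w \<in> measure_support P. (INF \<delta>\<in>recourse Bin. ereal (MAX j.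
          (Fx *v (?a + ?BB *v ?u \<omega> w + ?cc w) + Fd *v \<delta> + f w) $ j)) > 0}"
        and "w \<in> estimate (\<theta> \<omega>)"
      from sat(1)[OF this(2)] obtain \<delta> where \<delta>: "\<delta> \<in> recourse Bin"
        "\<forall>j. (Fx *v (?a + ?BB *v ?u \<omega> w + ?cc w) + Fd *v \<delta> + f w) $ j \<le> 0" by blast
      \<comment> \<open>The recourse of the selected cell bounds the infimum from above, so no point
        of the estimate is a violation.\<close>
      have "(INF \<delta>\<in>recourse Bin. ereal (MAX j.
          (Fx *v (?a + ?BB *v ?u \<omega> w + ?cc w) + Fd *v \<delta> + f w) $ j))
          \<le> ereal (MAX j. (Fx *v (?a + ?BB *v ?u \<omega> w + ?cc w) + Fd *v \<delta> + f w) $ j)"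
        by (rule INF_lower[OF \<delta>(1)])
      also have "\<dots> \<le> 0"
        using \<delta>(2) unfolding zero_ereal_def ereal_less_eq by (subst Max_le_iff) auto
      finally show False using w unfolding mem_Collect_eq by (blast dest: leD)
    qed
    show "V_s P Sx Su s ?a ?BB (?u \<omega>) \<le> measure P (- estimate (\<theta> \<omega>))"
      unfolding V_s_def
    proof (intro finite_measure_mono meas subsetI ComplI)
      fix w assume "w \<in> {w \<in> measure_support P.
          \<exists>j. (Sx *v (?a + ?BB *v ?u \<omega> w) + Su *v ?u \<omega> w + s w) $ j > 0}"
        and "w \<in> estimate (\<theta> \<omega>)"
      with sat(2)[OF this(2)] show False unfolding mem_Collect_eq by (blast dest: leD)
    qed
  qed
  then show ?thesis by (intro conjI bound)
qed

end
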